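(* Let $G$ be a digraph with path-width at most $k$. Then every minor of $G$ has path-width at most $k$.
   Context: All digraphs are finite (loops and parallel edges are allowed); an edge $uv$ has tail $u$ and head $v$. A digraph is strongly-connected if it is non-null and has a directed path from $u$ to $v$ for all vertices $u,v$. Minors: a digraph $H$ is a minor of a digraph $G$ if $H$ can be obtained from a subdigraph of $G$ by repeatedly contracting a strongly-connected subdigraph to a vertex. Equivalently, there is a minor mapping from $H$ to $G$, i.e. a mapping $\phi$ defined on $V(H)$ such that: (i) for every $v\in V(H)$, $\phi(v)$ is a non-null strongly-connected subdigraph of $G$; (ii) $\phi(u)$ and $\phi(v)$ are vertex-disjoint for distinct $u,v\in V(H)$; (iii) for all $u,v\in V(H)$ (not necessarily distinct), if there are $k$ edges of $H$ with tail $u$ and head $v$, then there are at least $k$ edges of $G$ with tail in $V(\phi(u))$ and head in $V(\phi(v))$ that are not contained in $E(\phi(x))$ for any $x\in V(H)$. Path-width: a path-decomposition of a digraph $G$ is a sequence $P=(W_1,\ldots,W_r)$ with $r\ge 1$ and $\bigcup_{1\le i\le r}W_i=V(G)$ such that $W_h\cap W_j\subseteq W_i$ whenever $1\le h<i<j\le r$ (betweenness condition), and for every edge $uv\in E(G)$ there exist $i,j$ with $1\le i\le j\le r$ such that $u\in W_j$ and $v\in W_i$ (cut condition). Its width is $\max_{1\le i\le r}|W_i|-1$. $G$ has path-width at most $k$ if it has a path-decomposition of width at most $k$. *)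

theory Defs
  imports "Graph_Theory.Graph_Theory"
begin

text \<open>
  Digraphs are records of type \<^typ>\<open>('a, 'b) pre_digraph\<close>; the locale \<^locale>\<open>fin_digraph\<close>
  admits loops, parallel arcs and the null digraph.  Subdigraphs are given by \<^const>\<open>subgraph\<close>,
  and \<^const>\<open>strongly_connected\<close> includes non-nullness.
\<close>

text \<open>
  Only the arcs of \<open>S\<close> itself disappear on contraction: arcs of \<open>G\<close> outside \<open>S\<close> with both ends in
  \<open>S\<close> survive as loops at the new vertex \<open>w\<close>.
\<close>
definition contract ::
  "('a, 'b) pre_digraph \<Rightarrow> ('a, 'b) pre_digraph \<Rightarrow> 'a \<Rightarrow> ('a, 'b) pre_digraph" where
  "contract G S w =
    \<lparr> verts = insert w (verts G - verts S),
      arcs = arcs G - arcs S,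
      tail = (\<lambda>e. if tail G e \<in> verts S then w else tail G e),
      head = (\<lambda>e. if head G e \<in> verts S then w else head G e) \<rparr>"

text \<open>
  The new vertex has to differ from all remaining vertices, but it may be one of the vertices
  of \<open>S\<close>; hence a contraction can always be carried out without leaving the vertex type.
\<close>
definition contraction_step :: "('a, 'b) pre_digraph \<Rightarrow> ('a, 'b) pre_digraph \<Rightarrow> bool" where
  "contraction_step G G' \<longleftrightarrow>
    (\<exists>S w. subgraph S G \<and> strongly_connected S \<and> w \<notin> verts G - verts S \<and> G' = contract G S w)"

text \<open>Minors are taken up to isomorphism, so the two digraphs may have different types.\<close>
definition minor :: "('c, 'd) pre_digraph \<Rightarrow> ('a, 'b) pre_digraph \<Rightarrow> bool" where
  "minor H G \<longleftrightarrow>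
    (\<exists>G0 G'. subgraph G0 G \<and> contraction_step\<^sup>*\<^sup>* G0 G' \<and> digraph_iso G' H)"

text \<open>A sequence \<open>W\<^sub>1, \<dots>, W\<^sub>r\<close> is a list, indexed from 0.\<close>
definition path_decomposition :: "('a, 'b) pre_digraph \<Rightarrow> 'a set list \<Rightarrow> bool" where
  "path_decomposition G W \<longleftrightarrow>
    W \<noteq> [] \<and>
    (\<Union>i<length W. W ! i) = verts G \<and>
    (\<forall>h i j. h < i \<and> i < j \<and> j < length W \<longrightarrow> W ! h \<inter> W ! j \<subseteq> W ! i) \<and>
    (\<forall>e\<in>arcs G. \<exists>i j. i \<le> j \<and> j < length W \<and> tail G e \<in> W ! j \<and> head G e \<in> W ! i)"

text \<open>The width is an integer because that of the null digraph's decompositions is -1.\<close>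
definition pd_width :: "'a set list \<Rightarrow> int" where
  "pd_width W = int (Max {card (W ! i) | i. i < length W}) - 1"

definition path_width_at_most :: "('a, 'b) pre_digraph \<Rightarrow> int \<Rightarrow> bool" where
  "path_width_at_most G k \<longleftrightarrow> (\<exists>W. path_decomposition G W \<and> pd_width W \<le> k)"

end

theory Submission
  imports Defs
begin

text \<open>
  Vertex deletion, contraction and renaming all act on vertices by a map \<open>q\<close>, defined on a set
  \<open>A\<close> of vertices of \<open>G\<close>, that carries the bags \<open>W\<^sub>i\<close> to the bags \<open>q(W\<^sub>i \<inter> A)\<close>. Taking images
  cannot enlarge a bag, and since every arc of the new digraph comes from an arc of \<open>G\<close> with
  both ends in \<open>A\<close>, the cut condition is inherited. The only condition at stake is betweenness:
  the bags that meet a given fibre of \<open>q\<close> have to be consecutive.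

  This is where strong connectivity enters. The cut condition lets an arc lead to an arbitrarily
  early bag, but it forbids an arc to jump forward over a bag: if all bags containing
  the tail precede \<open>W\<^sub>i\<close>, then some bag containing the head precedes \<open>W\<^sub>i\<close> as well. So a directed
  walk from a vertex left of \<open>W\<^sub>i\<close> to a vertex right of \<open>W\<^sub>i\<close> has a vertex in \<open>W\<^sub>i\<close>
  (\<open>path_decomposition_walk_meets_bag\<close>). In a strongly connected fibre such a walk exists between
  any two vertices, in particular in the direction that moves forward along the bags, so the
  fibre skips no bag (\<open>path_decomposition_image\<close>).
\<close>

lemma pd_width_le_iff:
  assumes "W \<noteq> []"
  shows "pd_width W \<le> k \<longleftrightarrow> (\<forall>i<length W. int (card (W ! i)) - 1 \<le> k)"
proof -
  let ?C = "{card (W ! i) | i. i < length W}"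
  have fin: "finite ?C" and ne: "?C \<noteq> {}"
    using assms by auto
  then have "Max ?C \<in> ?C"
    by (rule Max_in)
  moreover have "\<And>i. i < length W \<Longrightarrow> card (W ! i) \<le> Max ?C"
    using fin by (intro Max_ge) auto
  ultimately show ?thesis
    unfolding pd_width_def by fastforce
qed

text \<open>
  A walk whose start lies left of bag \<open>i\<close> stays left of it until it uses a vertex of that bag:
  by betweenness a vertex left of bag \<open>i\<close> and outside it occurs only to the left, and the cut
  condition then puts the head of each arc leaving it into an earlier bag.
\<close>

lemma path_decomposition_walk_meets_bag:
  assumes W: "path_decomposition G W"
    and R: "R \<subseteq> arcs_ends G"
    and walk: "(x, y) \<in> R\<^sup>*"
    and x: "x \<in> W ! h" and y: "y \<in> W ! j"
    and less: "h < i" "i < j" "j < length W"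
  shows "\<exists>z\<in>W ! i. (x, z) \<in> R\<^sup>*"
proof (rule ccontr)
  assume avoid: "\<not> ?thesis"
  have between: "\<And>a b v. v \<in> W ! a \<Longrightarrow> v \<in> W ! b \<Longrightarrow> a < i \<Longrightarrow> i < b \<Longrightarrow> b < length W
      \<Longrightarrow> v \<in> W ! i"
    using W unfolding path_decomposition_def by blast
  have "\<exists>a<i. y \<in> W ! a"
    using walk
  proof induction
    case base
    show ?case using x less by blast
  next
    case (step u v)
    then obtain a where a: "a < i" "u \<in> W ! a"
      by blast
    from step.hyps R obtain e where "e \<in> arcs G" "tail G e = u" "head G e = v"
      by (auto simp: arcs_ends_def arc_to_ends_def)
    then obtain c b where cb: "c \<le> b" "b < length W" "u \<in> W ! b" "v \<in> W ! c"
      using W unfolding path_decomposition_def by blast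
    have "u \<notin> W ! i"
      using avoid step.hyps by blast
    then have "b < i"
      using between[OF a(2) cb(3) a(1) _ cb(2)] cb(3) by (metis linorder_neqE_nat)
    then show ?case
      using cb by (meson le_less_trans)
  qed
  then show False
    using between y less avoid walk by blast
qed

text \<open>
  The closure of the relation below says that \<open>x\<close> is joined to \<open>y\<close> by a walk inside the fibre
  of \<open>q\<close>. For an injective \<open>q\<close> this is reflexivity, so the same statement covers deletion,
  contraction and renaming.
\<close>

lemma path_decomposition_image:
  fixes G :: "('a, 'b) pre_digraph" and H :: "('c, 'd) pre_digraph" and q :: "'a \<Rightarrow> 'c"
  assumes W: "path_decomposition G W"
    and A: "A \<subseteq> verts G"
    and verts: "verts H = q ` A"
    and arcs: "\<And>e. e \<in> arcs H \<Longrightarrow> \<exists>e'\<in>arcs G. tail G e' \<in> A \<and> head G e' \<in> A \<and>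
      tail H e = q (tail G e') \<and> head H e = q (head G e')"
    and fibres: "\<And>x y. x \<in> A \<Longrightarrow> y \<in> A \<Longrightarrow> q x = q y \<Longrightarrow>
      (x, y) \<in> {(u, v) \<in> arcs_ends G. u \<in> A \<and> v \<in> A \<and> q u = q v}\<^sup>*"
  shows "path_decomposition H (map (\<lambda>B. q ` (B \<inter> A)) W)" (is "path_decomposition H ?W'")
proof -
  define R where "R = {(u, v) \<in> arcs_ends G. u \<in> A \<and> v \<in> A \<and> q u = q v}"
  have R: "R \<subseteq> arcs_ends G"
    unfolding R_def by blast
  have fibre_closed: "z \<in> A \<and> q z = q x" if "(x, z) \<in> R\<^sup>*" "x \<in> A" for x z
    using that by induction (auto simp: R_def)
  have "?W' ! h \<inter> ?W' ! j \<subseteq> ?W' ! i" if less: "h < i" "i < j" "j < length W" for h i j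
  proof
    fix p assume "p \<in> ?W' ! h \<inter> ?W' ! j"
    then obtain x y where x: "x \<in> W ! h" "x \<in> A" "p = q x"
      and y: "y \<in> W ! j" "y \<in> A" "q x = q y"
      using less by auto
    have walk: "(x, y) \<in> R\<^sup>*"
      using fibres x y unfolding R_def by blast
    obtain z where "z \<in> W ! i" "(x, z) \<in> R\<^sup>*"
      using path_decomposition_walk_meets_bag[OF W R walk x(1) y(1) less] by blast
    moreover from this have "z \<in> A" "q z = p"
      using fibre_closed x(2,3) by simp_all
    ultimately have "p \<in> q ` (W ! i \<inter> A)"
      by blast
    then show "p \<in> ?W' ! i"
      using less by simp
  qed
  moreover have "(\<Union>i<length ?W'. ?W' ! i) = verts H"
  proof -
    have "(\<Union>i<length ?W'. ?W' ! i) = q ` ((\<Union>i<length W. W ! i) \<inter> A)"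
      by auto
    also have "\<dots> = verts H"
      using W A verts unfolding path_decomposition_def by (simp add: inf.absorb2)
    finally show ?thesis .
  qed
  moreover have "\<exists>i j. i \<le> j \<and> j < length ?W' \<and> tail H e \<in> ?W' ! j \<and> head H e \<in> ?W' ! i"
    if e: "e \<in> arcs H" for e
  proof -
    obtain e' where e': "e' \<in> arcs G" "tail G e' \<in> A" "head G e' \<in> A"
      "tail H e = q (tail G e')" "head H e = q (head G e')"
      using arcs[OF e] by blast
    obtain i j where "i \<le> j" "j < length W" "tail G e' \<in> W ! j" "head G e' \<in> W ! i"
      using W e'(1) unfolding path_decomposition_def by blast
    then show ?thesis
      using e' by (intro exI[of _ i] exI[of _ j]) auto
  qed
  ultimately show ?thesis
    using W unfolding path_decomposition_def by simp
qed

text \<open>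
  Finiteness guarantees that taking images does not increase cardinality: the cardinality of an
  infinite bag is 0 by convention, while its image might be finite and nonempty.
\<close>

lemma path_width_at_most_image:
  fixes G :: "('a, 'b) pre_digraph" and H :: "('c, 'd) pre_digraph" and q :: "'a \<Rightarrow> 'c"
  assumes fin: "finite (verts G)"
    and pw: "path_width_at_most G k"
    and "A \<subseteq> verts G"
    and "verts H = q ` A"
    and "\<And>e. e \<in> arcs H \<Longrightarrow> \<exists>e'\<in>arcs G. tail G e' \<in> A \<and> head G e' \<in> A \<and>
      tail H e = q (tail G e') \<and> head H e = q (head G e')"
    and "\<And>x y. x \<in> A \<Longrightarrow> y \<in> A \<Longrightarrow> q x = q y \<Longrightarrow>
      (x, y) \<in> {(u, v) \<in> arcs_ends G. u \<in> A \<and> v \<in> A \<and> q u = q v}\<^sup>*"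
  shows "path_width_at_most H k"
proof -
  obtain W where W: "path_decomposition G W" and width: "pd_width W \<le> k"
    using pw unfolding path_width_at_most_def by blast
  let ?W' = "map (\<lambda>B. q ` (B \<inter> A)) W"
  have "W \<noteq> []" and union: "(\<Union>i<length W. W ! i) = verts G"
    using W unfolding path_decomposition_def by blast+
  have "card (?W' ! i) \<le> card (W ! i)" if "i < length W" for i
  proof -
    have "finite (W ! i)"
      using that union fin by (auto intro: finite_subset)
    then have "card (q ` (W ! i \<inter> A)) \<le> card (W ! i)"
      by (meson card_image_le card_mono finite_Int inf_le1 order_trans)
    then show ?thesis
      using that by simp
  qed
  then have "pd_width ?W' \<le> k"
    using width \<open>W \<noteq> []\<close> by (fastforce simp: pd_width_le_iff)
  moreover have "path_decomposition H ?W'"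
    using W assms(3-6) by (rule path_decomposition_image)
  ultimately show ?thesis
    unfolding path_width_at_most_def by blast
qed

lemma path_width_at_most_subgraph:
  assumes fin: "finite (verts G)" and pw: "path_width_at_most G k" and sub: "subgraph G0 G"
  shows "path_width_at_most G0 k"
proof (rule path_width_at_most_image[OF fin pw, where A = "verts G0" and q = id])
  show "verts G0 \<subseteq> verts G"
    using sub by blast
  fix e assume "e \<in> arcs G0"
  moreover have "wf_digraph G0" "arcs G0 \<subseteq> arcs G" "compatible G G0"
    using sub unfolding subgraph_def by auto
  ultimately show "\<exists>e'\<in>arcs G. tail G e' \<in> verts G0 \<and> head G e' \<in> verts G0 \<and>
      tail G0 e = id (tail G e') \<and> head G0 e = id (head G e')"
    by (intro bexI[of _ e]) (auto simp: compatible_def wf_digraph_def)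
qed auto

lemma path_width_at_most_digraph_iso:
  fixes G :: "('a, 'b) pre_digraph" and H :: "('c, 'd) pre_digraph"
  assumes fin: "finite (verts G)" and pw: "path_width_at_most G k" and iso: "digraph_iso G H"
  shows "path_width_at_most H k"
proof -
  obtain f where f: "pre_digraph.digraph_isomorphism G f" and H: "H = app_iso f G"
    using iso unfolding digraph_iso_def by blast
  have wf: "wf_digraph G"
    using f unfolding pre_digraph.digraph_isomorphism_def by blast
  show ?thesis
  proof (rule path_width_at_most_image[OF fin pw, where A = "verts G" and q = "iso_verts f"])
    fix e assume "e \<in> arcs H"
    then obtain e' where e': "e' \<in> arcs G" "e = iso_arcs f e'"
      using H by auto
    then show "\<exists>e'\<in>arcs G. tail G e' \<in> verts G \<and> head G e' \<in> verts G \<and>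
        tail H e = iso_verts f (tail G e') \<and> head H e = iso_verts f (head G e')"
      using f H wf by (intro bexI[of _ e'])
        (auto simp: pre_digraph.iso_verts_tail pre_digraph.iso_verts_head wf_digraph_def)
  next
    fix x y assume "x \<in> verts G" "y \<in> verts G" "iso_verts f x = iso_verts f y"
    then have "x = y"
      using f by (simp add: pre_digraph.iso_verts_eq_iff)
    then show "(x, y) \<in> {(u, v) \<in> arcs_ends G. u \<in> verts G \<and> v \<in> verts G \<and>
        iso_verts f u = iso_verts f v}\<^sup>*"
      by simp
  qed (auto simp: H)
qed

text \<open>
  Here \<open>q\<close> sends all of \<open>S\<close> to \<open>w\<close>. As \<open>w\<close> is not a vertex outside \<open>S\<close>, the only nontrivial fibre
  is \<open>S\<close> itself.
\<close>

lemma path_width_at_most_contraction_step: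
  fixes G :: "('a, 'b) pre_digraph"
  assumes fin: "finite (verts G)" and pw: "path_width_at_most G k"
    and step: "contraction_step G G'"
  shows "path_width_at_most G' k"
proof -
  obtain S w where S: "subgraph S G" "strongly_connected S"
    and w: "w \<notin> verts G - verts S" and G': "G' = contract G S w"
    using step unfolding contraction_step_def by blast
  define q where "q = (\<lambda>x. if x \<in> verts S then w else x)"
  have S_sub: "verts S \<subseteq> verts G" "arcs S \<subseteq> arcs G" "tail S = tail G" "head S = head G"
    and wf: "wf_digraph G" "wf_digraph S"
    using S(1) unfolding subgraph_def compatible_def by auto
  show ?thesis
  proof (rule path_width_at_most_image[OF fin pw, where A = "verts G" and q = q])
    have "verts S \<noteq> {}"
      using S(2) unfolding strongly_connected_def by blast
    then show "verts G' = q ` verts G"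
      using S_sub(1) unfolding G' contract_def q_def by (auto simp: image_iff)
  next
    fix e assume "e \<in> arcs G'"
    then show "\<exists>e'\<in>arcs G. tail G e' \<in> verts G \<and> head G e' \<in> verts G \<and>
        tail G' e = q (tail G e') \<and> head G' e = q (head G e')"
      using wf(1) unfolding G' contract_def q_def
      by (intro bexI[of _ e]) (auto simp: wf_digraph_def)
  next
    fix x y assume xy: "x \<in> verts G" "y \<in> verts G" "q x = q y"
    let ?R = "{(u, v) \<in> arcs_ends G. u \<in> verts G \<and> v \<in> verts G \<and> q u = q v}"
    show "(x, y) \<in> ?R\<^sup>*"
    proof (cases "x = y")
      case False
      then have "x \<in> verts S" "y \<in> verts S"
        using xy w unfolding q_def by (auto split: if_splits)
      then have "(x, y) \<in> rtrancl_on (verts S) (arcs_ends S)"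
        using S(2) unfolding strongly_connected_def reachable_def by blast
      then have "(x, y) \<in> (arcs_ends S)\<^sup>*"
        by (rule rtrancl_on_rtranclI)
      moreover have "arcs_ends S \<subseteq> ?R"
        using S_sub wf(2) unfolding q_def
        by (fastforce simp: arcs_ends_def arc_to_ends_def wf_digraph_def)
      ultimately show ?thesis
        using rtrancl_mono by blast
    qed simp
  qed simp
qed

lemma path_width_at_most_contraction_steps:
  assumes "contraction_step\<^sup>*\<^sup>* G G'" and "finite (verts G)" and "path_width_at_most G k"
  shows "finite (verts G') \<and> path_width_at_most G' k"
  using assms
proof (induction rule: rtranclp_induct)
  case (step G1 G2)
  then have "finite (verts G2)"
    by (auto simp: contraction_step_def contract_def)
  then show ?case
    using step path_width_at_most_contraction_step by blast
qed simp

theorem mainTheorem2: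
  fixes G :: "('a, 'b) pre_digraph" and H :: "('c, 'd) pre_digraph" and k :: int
  assumes "fin_digraph G"
    and "path_width_at_most G k"
    and "minor H G"
  shows "path_width_at_most H k"
proof -
  obtain G0 G' where sub: "subgraph G0 G" and steps: "contraction_step\<^sup>*\<^sup>* G0 G'"
    and iso: "digraph_iso G' H"
    using assms(3) unfolding minor_def by blast
  have fin: "finite (verts G)"
    using assms(1) by (rule fin_digraph.finite_verts)
  then have "finite (verts G0)"
    using sub by (auto simp: subgraph_def intro: finite_subset)
  moreover have "path_width_at_most G0 k"
    using fin assms(2) sub by (rule path_width_at_most_subgraph)
  ultimately have "finite (verts G')" "path_width_at_most G' k"
    using path_width_at_most_contraction_steps[OF steps] by auto
  then show ?thesis
    using iso by (rule path_width_at_most_digraph_iso)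
qed

end
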